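(* Let $g$ lie in $\mathrm{dom}(\Sigma)$ and let $m\in\mathbb{N}^*$. Define the function $g_m\colon\mathbb{R}_+\to\mathbb{R}$ by $g_m(x)=g\left(\frac{x}{m}\right)$ for $x>0$. Then $$\sum_{j=0}^{m-1}\Sigma g\left(\frac{x+j}{m}\right)=\sum_{j=1}^m\Sigma g\left(\frac{j}{m}\right)+\Sigma g_m(x),\qquad x>0,$$ and $$\Sigma g_m(m)=\sum_{j=1}^{m-1}g\left(\frac{j}{m}\right).$$
   Context: $\mathbb{N}^*=\{1,2,\ldots\}$, $\mathbb{R}_+=(0,\infty)$, $\Delta f(x)=f(x+1)-f(x)$. For an integer $p\ge -1$, a function $f\colon I\to\mathbb{R}$ on a real interval $I$ is $p$-convex (resp. $p$-concave) if for all $x_0<\cdots<x_{p+1}$ in $I$ the divided difference $f[x_0,\ldots,x_{p+1}]$ is $\ge 0$ (resp. $\le 0$), where $f[x_0,\ldots,x_n]=\sum_{k=0}^n f(x_k)/\prod_{j\ne k}(x_k-x_j)$. $\mathcal{K}^p$ is the set of functions $\mathbb{R}_+\to\mathbb{R}$ that are $p$-convex on some $[a,\infty)$ or $p$-concave on some $[a,\infty)$. $\mathcal{D}^p$ is the set of $g\colon\mathbb{R}_+\to\mathbb{R}$ with $\Delta^pg(n)\to 0$ as $n\to\infty$ over the integers. $\mathrm{dom}(\Sigma)=\bigcup_{p\ge0}(\mathcal{D}^p\cap\mathcal{K}^p)$. For $g\in\mathcal{D}^p\cap\mathcal{K}^p$, the function $\Sigma g\colon\mathbb{R}_+\to\mathbb{R}$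 is $$\Sigma g(x)=\lim_{n\to\infty}\Big(-g(x)+\sum_{k=1}^{n-1}(g(k)-g(x+k))+\sum_{j=1}^p\binom{x}{j}\Delta^{j-1}g(n)\Big);$$ the limit exists, does not depend on the choice of such $p$, and $\Sigma g$ is the unique solution $f\in\mathcal{K}^p$ of $\Delta f=g$ with $f(1)=0$. $\Sigma g_m$ denotes the map $\Sigma$ applied to the function $g_m$ (which also lies in $\mathrm{dom}(\Sigma)$). *)

theory Defs
  imports Complex_Main
begin

text \<open>
  A function \<open>f : \<real>\<^sub>+ \<rightarrow> \<real>\<close> with \<open>\<real>\<^sub>+ = (0, \<infinity>)\<close> is represented by a total function
  of type \<open>real \<Rightarrow> real\<close>. None of the notions below, \<open>Sigma_map g x\<close> being taken at \<open>x > 0\<close>,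
  depends on the values at non-positive arguments.
\<close>

definition fdiff :: "(real \<Rightarrow> real) \<Rightarrow> real \<Rightarrow> real" where
  "fdiff f x = f (x + 1) - f x"

text \<open>The divided difference \<open>f[x 0, \<dots>, x n]\<close>; the nodes are the first \<open>n + 1\<close> values of \<open>x\<close>.\<close>

definition divided_diff :: "(real \<Rightarrow> real) \<Rightarrow> (nat \<Rightarrow> real) \<Rightarrow> nat \<Rightarrow> real" where
  "divided_diff f x n = (\<Sum>k\<le>n. f (x k) / (\<Prod>j\<in>{..n} - {k}. x k - x j))"

text \<open>Only orders \<open>p \<ge> 0\<close> occur in the domain of \<open>Sigma_map\<close>, hence \<open>p\<close> is a natural number.\<close>

definition p_convex_on :: "nat \<Rightarrow> real set \<Rightarrow> (real \<Rightarrow> real) \<Rightarrow> bool" where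
  "p_convex_on p I f \<longleftrightarrow>
     (\<forall>x. strict_mono_on {..p + 1} x \<and> x ` {..p + 1} \<subseteq> I \<longrightarrow> divided_diff f x (p + 1) \<ge> 0)"

definition p_concave_on :: "nat \<Rightarrow> real set \<Rightarrow> (real \<Rightarrow> real) \<Rightarrow> bool" where
  "p_concave_on p I f \<longleftrightarrow>
     (\<forall>x. strict_mono_on {..p + 1} x \<and> x ` {..p + 1} \<subseteq> I \<longrightarrow> divided_diff f x (p + 1) \<le> 0)"

definition K_class :: "nat \<Rightarrow> (real \<Rightarrow> real) set" where
  "K_class p = {f. \<exists>a>0. p_convex_on p {a..} f \<or> p_concave_on p {a..} f}"

definition D_class :: "nat \<Rightarrow> (real \<Rightarrow> real) set" where
  "D_class p = {g. (\<lambda>n::nat. (fdiff ^^ p) g (real n)) \<longlonglongrightarrow> 0}"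

definition dom_Sigma :: "(real \<Rightarrow> real) set" where
  "dom_Sigma = (\<Union>p. D_class p \<inter> K_class p)"

definition Sigma_approx :: "nat \<Rightarrow> (real \<Rightarrow> real) \<Rightarrow> nat \<Rightarrow> real \<Rightarrow> real" where
  "Sigma_approx p g n x =
     - g x + (\<Sum>k\<in>{1..<n}. g (real k) - g (x + real k))
           + (\<Sum>j=1..p. (x gchoose j) * (fdiff ^^ (j - 1)) g (real n))"

text \<open>
  For \<open>g \<in> D_class p \<inter> K_class p\<close> and \<open>x > 0\<close> the limit of \<open>Sigma_approx p g n x\<close> exists and is
  the same for all such \<open>p\<close>; the least \<open>p\<close> is taken merely to fix a choice.
\<close>

definition Sigma_map :: "(real \<Rightarrow> real) \<Rightarrow> real \<Rightarrow> real" where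
  "Sigma_map g x =
     lim (\<lambda>n. Sigma_approx (LEAST p. g \<in> D_class p \<inter> K_class p) g n x)"

end

theory Submission
  imports Defs "HOL-Computational_Algebra.Polynomial"
begin

text \<open>
  Everything is controlled by one quantity, the remainder \<open>newton_remainder (Suc p) f n x\<close> of the
  Newton interpolation of \<open>f\<close> at the nodes \<open>n, \<dots>, n + p\<close>, evaluated at \<open>n + x\<close>. It is linked to
  \<open>\<Sigma>\<close> in two ways. The increments of \<open>Sigma_approx p g n x\<close> in \<open>n\<close> are minus the remainders of \<open>g\<close>
  (\<open>Sigma_approx_Suc\<close>); and if \<open>\<Delta>f = g\<close>, then \<open>Sigma_approx p g n x\<close> is \<open>f x - f 1\<close> minus the
  remainder of \<open>f\<close> (\<open>Sigma_approx_eq_remainder\<close>).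

  By the first link, \<open>\<Sigma>g\<close> exists once the remainders of \<open>g\<close> are summable in \<open>n\<close>. A divided
  difference on the nodes \<open>n, \<dots>, n + p, n + x\<close> is the remainder divided by a product of node
  distances, so \<open>p\<close>-convexity says that the remainder changes sign whenever \<open>x\<close> crosses one of
  \<open>1, \<dots>, p\<close>. Opposite signs at \<open>x\<close> and \<open>x + 1\<close> mean that both values are bounded by their
  difference, and that difference is the remainder of \<open>\<Delta>f\<close> of order one less. Induction on \<open>p\<close>
  reduces the summability to a telescoping series for a monotone function
  (\<open>summable_newton_remainder_convex\<close>). The equation \<open>\<Delta>(\<Sigma>g) = g\<close> with \<open>\<Sigma>g(1) = 0\<close> follows.

  By the second link, a solution \<open>f\<close> of \<open>\<Delta>f = h\<close> is \<open>\<Sigma>h\<close> up to a constant as soon as its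
  remainders tend to \<open>0\<close> (\<open>Sigma_map_eqI\<close>). For the multiplication formula this applies with
  \<open>h = g_m\<close> and \<open>f = F\<close>, where \<open>F x = (\<Sum>j<m. \<Sigma>g ((x + j) / m))\<close>, since \<open>\<Delta>F = g_m\<close> by
  telescoping. To see that the remainders of \<open>F\<close> vanish in the limit without any further convexity
  argument, note that they do so for all \<open>x \<ge> 0\<close> exactly when the function is, as \<open>n \<rightarrow> \<infinity>\<close>,
  a polynomial of degree at most \<open>p\<close> up to \<open>o(1)\<close> at each fixed distance beyond \<open>n\<close>
  (\<open>asymp_poly\<close>). This property survives sums and affine substitutions, so it passes from
  \<open>\<Sigma>g\<close> to \<open>F\<close>. It also yields \<open>\<Delta>\<^sup>p g_m = \<Delta>\<^sup>p\<^sup>+\<^sup>1 F \<rightarrow> 0\<close> along the integers, which puts \<open>g_m\<close> in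
  the domain of \<open>\<Sigma>\<close>. Finally \<open>F 1\<close> is the constant in the formula, and evaluating at \<open>x = m\<close>
  gives the second claim.
\<close>

section \<open>Newton interpolation at equidistant nodes\<close>

text \<open>
  The sum is the Newton form of the polynomial of degree less than \<open>q\<close> in \<open>x\<close> that agrees with
  \<open>f (u + x)\<close> at \<open>x = 0, \<dots>, q - 1\<close>. Counting the terms rather than the degree admits the empty
  interpolation \<open>q = 0\<close>, whose remainder is \<open>f (u + x)\<close> itself; it arises from the recursion below.
\<close>

definition newton_remainder :: "nat \<Rightarrow> (real \<Rightarrow> real) \<Rightarrow> real \<Rightarrow> real \<Rightarrow> real" where
  "newton_remainder q f u x = f (u + x) - (\<Sum>j<q. (x gchoose j) * (fdiff ^^ j) f u)"

lemma fdiff_funpow_Suc: "(fdiff ^^ Suc j) f = (fdiff ^^ j) (fdiff f)"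
  by (simp add: funpow_Suc_right del: funpow.simps)

lemma fdiff_funpow_Suc_at: "(fdiff ^^ Suc j) f u = (fdiff ^^ j) f (u + 1) - (fdiff ^^ j) f u"
  by (simp add: fdiff_def[of "(fdiff ^^ j) f"])

lemma fdiff_funpow_cong:
  assumes "\<And>x. x \<ge> u \<Longrightarrow> f x = h x"
  shows "(fdiff ^^ j) f u = (fdiff ^^ j) h u"
  using assms
proof (induction j arbitrary: u)
  case (Suc j)
  have "(fdiff ^^ j) f (u + 1) = (fdiff ^^ j) h (u + 1)"
    by (rule Suc.IH) (use Suc.prems in auto)
  moreover have "(fdiff ^^ j) f u = (fdiff ^^ j) h u"
    by (rule Suc.IH) (use Suc.prems in auto)
  ultimately show ?case by (simp only: fdiff_funpow_Suc_at)
qed simp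

lemma fdiff_funpow_diff:
  "(fdiff ^^ j) (\<lambda>x. f x - h x) u = (fdiff ^^ j) f u - (fdiff ^^ j) h u"
  by (induction j arbitrary: u) (simp_all add: fdiff_funpow_Suc_at del: funpow.simps(2))

lemma fdiff_funpow_minus: "(fdiff ^^ j) (\<lambda>x. - f x) u = - (fdiff ^^ j) f u"
  by (induction j arbitrary: u) (simp_all add: fdiff_funpow_Suc_at del: funpow.simps(2))

lemma newton_remainder_diff:
  "newton_remainder q (\<lambda>x. f x - h x) u x = newton_remainder q f u x - newton_remainder q h u x"
  by (simp add: newton_remainder_def fdiff_funpow_diff sum_subtractf algebra_simps)

lemma newton_remainder_minus:
  "newton_remainder q (\<lambda>x. - f x) u x = - newton_remainder q f u x"
  by (simp add: newton_remainder_def fdiff_funpow_minus sum_negf)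

lemma newton_remainder_Suc:
  "newton_remainder (Suc q) f u x = newton_remainder q f u x - (x gchoose q) * (fdiff ^^ q) f u"
  by (simp add: newton_remainder_def)

lemma newton_remainder_at_0: "newton_remainder (Suc q) f u 0 = 0"
  by (simp add: newton_remainder_def sum.lessThan_Suc_shift del: sum.lessThan_Suc)

text \<open>
  Pascal's rule turns the difference in \<open>x\<close> of the interpolation polynomial of \<open>f\<close> into the
  interpolation polynomial of \<open>\<Delta>f\<close>. This recursion drives all inductions on the order.
\<close>

lemma newton_remainder_step:
  "newton_remainder (Suc q) f u (x + 1) =
     newton_remainder (Suc q) f u x + newton_remainder q (fdiff f) u x"
proof -
  have "(\<Sum>j<Suc q. ((x + 1) gchoose j) * (fdiff ^^ j) f u)
        = f u + (\<Sum>j<q. ((x gchoose j) + (x gchoose Suc j)) * (fdiff ^^ Suc j) f u)"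
    by (simp add: sum.lessThan_Suc_shift gbinomial_Suc_Suc del: sum.lessThan_Suc funpow.simps(2))
  moreover have "(\<Sum>j<Suc q. (x gchoose j) * (fdiff ^^ j) f u)
        = f u + (\<Sum>j<q. (x gchoose Suc j) * (fdiff ^^ Suc j) f u)"
    by (simp add: sum.lessThan_Suc_shift del: sum.lessThan_Suc funpow.simps(2))
  moreover have "fdiff f (u + x) = f (u + (x + 1)) - f (u + x)"
    by (simp add: fdiff_def add_ac)
  ultimately show ?thesis
    by (simp add: newton_remainder_def fdiff_funpow_Suc distrib_right sum.distrib
        del: sum.lessThan_Suc funpow.simps(2))
qed

lemma newton_remainder_node: "k < q \<Longrightarrow> newton_remainder q f u (real k) = 0"
proof (induction k arbitrary: q f)
  case 0
  then obtain q' where "q = Suc q'" by (cases q) auto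
  then show ?case by (simp add: newton_remainder_at_0)
next
  case (Suc k)
  then obtain q' where q: "q = Suc q'" and k: "k < q'" by (cases q) auto
  have "newton_remainder q f u (real k) = 0" by (rule Suc.IH) (use q k in auto)
  moreover have "newton_remainder q' (fdiff f) u (real k) = 0" by (rule Suc.IH[OF k])
  ultimately show ?case
    using newton_remainder_step[of q' f u "real k"] by (simp add: q add.commute)
qed

definition gbinomial_poly :: "nat \<Rightarrow> real poly" where
  "gbinomial_poly j = smult (1 / fact j) (\<Prod>i<j. [:- real i, 1:])"

lemma poly_gbinomial_poly: "poly (gbinomial_poly j) x = x gchoose j"
  by (simp add: gbinomial_poly_def gbinomial_prod_rev poly_prod atLeast0LessThan)

lemma degree_gbinomial_poly: "degree (gbinomial_poly j) \<le> j"
  by (simp add: gbinomial_poly_def degree_prod_sum_eq)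

text \<open>
  The Newton sum is needed as an object of type \<open>real poly\<close> so that root counting applies to it.
\<close>

definition newton_poly :: "nat \<Rightarrow> (real \<Rightarrow> real) \<Rightarrow> real \<Rightarrow> real poly" where
  "newton_poly p f u = (\<Sum>j<Suc p. smult ((fdiff ^^ j) f u) (gbinomial_poly j))"

lemma degree_newton_poly: "degree (newton_poly p f u) \<le> p"
  unfolding newton_poly_def
  by (intro degree_sum_le) (auto intro: order.trans[OF degree_smult_le] order.trans[OF degree_gbinomial_poly])

lemma newton_remainder_eq_poly:
  "newton_remainder (Suc p) f u x = f (u + x) - poly (newton_poly p f u) x"
  by (simp add: newton_remainder_def newton_poly_def poly_sum poly_gbinomial_poly mult.commute
      del: sum.lessThan_Suc)

text \<open>
  Interpolation is exact on polynomials: two polynomials of degree at most \<open>p\<close> that agree at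
  \<open>p + 1\<close> points are equal.
\<close>

lemma newton_remainder_poly:
  assumes "degree P \<le> p"
  shows "newton_remainder (Suc p) (poly P) u x = 0"
proof -
  define Q where "Q = pcompose P [:u, 1:]"
  have Q: "poly Q y = poly P (u + y)" for y
    by (simp add: Q_def poly_pcompose)
  have "degree Q \<le> p"
    using degree_pcompose_le[of P "[:u, 1:]"] assms by (simp add: Q_def)
  moreover have "degree (newton_poly p (poly P) u) \<le> p" by (rule degree_newton_poly)
  moreover have "card (real ` {..p}) = Suc p" by (simp add: card_image)
  moreover have "poly Q y = poly (newton_poly p (poly P) u) y" if "y \<in> real ` {..p}" for y
  proof -
    from that obtain k where k: "y = real k" "k < Suc p" by auto
    then show ?thesis
      using newton_remainder_node[of k "Suc p" "poly P" u]
      by (simp add: newton_remainder_eq_poly Q)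
  qed
  ultimately have "Q = newton_poly p (poly P) u"
    by (intro poly_eqI_degree[of "real ` {..p}"]) auto
  then show ?thesis by (simp add: newton_remainder_eq_poly flip: Q)
qed

section \<open>Divided differences and the sign of the Newton remainder\<close>

text \<open>
  The divided difference of order \<open>n\<close> is the coefficient of degree \<open>n\<close> of the Lagrange interpolation
  polynomial, and that polynomial is \<open>P\<close> itself.
\<close>

lemma divided_diff_poly:
  assumes "degree P < n" and inj: "inj_on x {..n}"
  shows "divided_diff (poly P) x n = 0"
proof -
  define c where "c k = poly P (x k) / (\<Prod>j\<in>{..n} - {k}. x k - x j)" for k
  define B where "B k = (\<Prod>j\<in>{..n} - {k}. [:- x j, 1:])" for k
  define L where "L = (\<Sum>k\<le>n. smult (c k) (B k))"
  have degB: "degree (B k) = n" if "k \<le> n" for k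
    using that by (simp add: B_def degree_prod_sum_eq)
  have coeffB: "coeff (B k) n = 1" if "k \<le> n" for k
    using lead_coeff_prod[of "\<lambda>j. [:- x j, 1:]" "{..n} - {k}"] degB[OF that]
    by (simp add: B_def)
  have polyB: "poly (B k) y = (\<Prod>j\<in>{..n} - {k}. y - x j)" for k y
    by (simp add: B_def poly_prod)
  have "degree L \<le> n"
    unfolding L_def by (intro degree_sum_le) (auto intro!: order.trans[OF degree_smult_le] simp: degB)
  moreover have "degree P \<le> n" using assms by simp
  moreover have "poly L y = poly P y" if "y \<in> x ` {..n}" for y
  proof -
    from that obtain i where i: "i \<le> n" "y = x i" by auto
    have zero: "(\<Prod>j\<in>{..n} - {k}. x i - x j) = 0" if "k \<in> {..n} - {i}" for k
      using that i by (intro prod_zero) auto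
    have "(\<Prod>j\<in>{..n} - {i}. x i - x j) \<noteq> 0"
      using inj i by (auto simp: inj_on_def)
    moreover have "(\<Sum>k\<in>{..n} - {i}. c k * (\<Prod>j\<in>{..n} - {k}. x i - x j)) = 0"
      by (intro sum.neutral ballI) (simp only: zero mult_zero_right)
    ultimately show ?thesis
      using i by (simp add: L_def poly_sum polyB sum.remove[of "{..n}" i] c_def del: prod_zero_iff)
  qed
  moreover have "card (x ` {..n}) = Suc n" using inj by (simp add: card_image)
  ultimately have "L = P"
    by (intro poly_eqI_degree[of "x ` {..n}"]) auto
  moreover have "coeff L n = (\<Sum>k\<le>n. c k)"
    by (simp add: L_def coeff_sum coeffB)
  moreover have "coeff P n = 0" using assms(1) by (rule coeff_eq_0)
  ultimately show ?thesis by (simp add: divided_diff_def c_def)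
qed

lemma sign_node_product:
  fixes x :: "nat \<Rightarrow> real"
  assumes "strict_mono_on {..n} x" "k \<le> n"
  shows "0 < (- 1) ^ (n - k) * (\<Prod>j\<in>{..n} - {k}. x k - x j)"
proof -
  have lt: "x i < x j" if "i < j" "j \<le> n" for i j
    using assms(1) that by (auto simp: strict_mono_on_def)
  have split: "{..n} - {k} = {..<k} \<union> {k<..n}" using assms(2) by auto
  have "(\<Prod>j\<in>{..n} - {k}. x k - x j) = (\<Prod>j<k. x k - x j) * (\<Prod>j\<in>{k<..n}. x k - x j)"
    unfolding split by (rule prod.union_disjoint) auto
  also have "(\<Prod>j\<in>{k<..n}. x k - x j) = (\<Prod>j\<in>{k<..n}. (- 1) * (x j - x k))"
    by (intro prod.cong) auto
  also have "\<dots> = (- 1) ^ (n - k) * (\<Prod>j\<in>{k<..n}. x j - x k)"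
    by (subst prod.distrib) simp
  finally have "(- 1) ^ (n - k) * (\<Prod>j\<in>{..n} - {k}. x k - x j) =
      (\<Prod>j<k. x k - x j) * (\<Prod>j\<in>{k<..n}. x j - x k)"
    by (simp add: algebra_simps flip: power_add mult_2)
  moreover have "0 < (\<Prod>j<k. x k - x j)" using lt assms(2) by (intro prod_pos) auto
  moreover have "0 < (\<Prod>j\<in>{k<..n}. x j - x k)" using lt by (intro prod_pos) auto
  ultimately show ?thesis by simp
qed

text \<open>
  The trace of \<open>p\<close>-convexity that the summability argument needs: the remainder is nonnegative on
  \<open>(p, p + 1)\<close> and changes sign from each unit interval to the preceding one. Unlike the definition
  by divided differences, it descends to \<open>\<Delta>f\<close> by a one-line computation.
\<close>

definition alternating_remainder :: "nat \<Rightarrow> real \<Rightarrow> (real \<Rightarrow> real) \<Rightarrow> bool" where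
  "alternating_remainder p a f \<longleftrightarrow>
     (\<forall>u\<ge>a. \<forall>i\<le>p. \<forall>x. real i < x \<and> x < real i + 1 \<longrightarrow>
        0 \<le> (- 1) ^ (p - i) * newton_remainder (Suc p) f u x)"

text \<open>
  The divided difference at \<open>u, \<dots>, u + p\<close> together with \<open>u + x\<close> does not change when the
  interpolation polynomial is subtracted from \<open>f\<close>. What remains vanishes at all nodes except
  \<open>u + x\<close>, where it is the remainder, so only one term of the divided difference survives.
\<close>

lemma p_convex_imp_alternating_remainder:
  assumes "p_convex_on p {a..} f"
  shows "alternating_remainder p a f"
  unfolding alternating_remainder_def
proof (intro allI impI)
  fix u x :: real and i :: nat
  assume u: "a \<le> u" and i: "i \<le> p" and x: "real i < x \<and> x < real i + 1"
  \<comment> \<open>the nodes in increasing order, with \<open>u + x\<close> at position \<open>i + 1\<close>\<close>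
  define y where "y k = (if k \<le> i then u + real k else if k = Suc i then u + x
    else u + real (k - 1))" for k
  have mono: "strict_mono_on {..p + 1} y"
    using x by (auto simp: strict_mono_on_def y_def)
  moreover have "y ` {..p + 1} \<subseteq> {a..}" using u x by (auto simp: y_def)
  ultimately have pos: "0 \<le> divided_diff f y (p + 1)"
    using assms unfolding p_convex_on_def by blast
  define Q where "Q = pcompose (newton_poly p f u) [:- u, 1:]"
  define h where "h z = f z - poly Q z" for z
  have h: "h (u + t) = newton_remainder (Suc p) f u t" for t
    by (simp add: h_def Q_def poly_pcompose newton_remainder_eq_poly)
  have "degree Q < p + 1"
    using degree_pcompose_le[of "newton_poly p f u" "[:- u, 1:]"] degree_newton_poly[of p f u]
    by (simp add: Q_def)
  moreover have "inj_on y {..p + 1}" using mono by (rule strict_mono_on_imp_inj_on)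
  ultimately have "divided_diff (poly Q) y (p + 1) = 0" by (rule divided_diff_poly)
  then have "divided_diff f y (p + 1) = divided_diff h y (p + 1)"
    by (simp add: divided_diff_def h_def diff_divide_distrib sum_subtractf)
  also have "\<dots> = h (y (Suc i)) / (\<Prod>j\<in>{..p + 1} - {Suc i}. y (Suc i) - y j)"
  proof -
    have "h (y k) = 0" if "k \<in> {..p + 1} - {Suc i}" for k
    proof -
      have "\<exists>l<Suc p. y k = u + real l"
        using that i by (auto simp: y_def intro: exI[of _ k] exI[of _ "k - 1"])
      then show ?thesis by (auto simp: h newton_remainder_node)
    qed
    then show ?thesis
      unfolding divided_diff_def using i by (subst sum.remove[of _ "Suc i"]) auto
  qed
  also have "h (y (Suc i)) = newton_remainder (Suc p) f u x" by (simp add: y_def h)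
  finally have dd: "divided_diff f y (p + 1) =
    newton_remainder (Suc p) f u x / (\<Prod>j\<in>{..p + 1} - {Suc i}. y (Suc i) - y j)" .
  have prod: "0 < (- 1) ^ (p - i) * (\<Prod>j\<in>{..p + 1} - {Suc i}. y (Suc i) - y j)"
    using sign_node_product[OF mono, of "Suc i"] i by simp
  then have "newton_remainder (Suc p) f u x =
      divided_diff f y (p + 1) * (\<Prod>j\<in>{..p + 1} - {Suc i}. y (Suc i) - y j)"
    unfolding dd by (intro nonzero_divide_eq_eq[THEN iffD1, OF _ refl]) (use prod in \<open>auto simp del: prod_zero_iff\<close>)
  then have "(- 1) ^ (p - i) * newton_remainder (Suc p) f u x = divided_diff f y (p + 1) *
      ((- 1) ^ (p - i) * (\<Prod>j\<in>{..p + 1} - {Suc i}. y (Suc i) - y j))"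
    by simp
  also have "\<dots> \<ge> 0" by (rule mult_nonneg_nonneg[OF pos less_imp_le[OF prod]])
  finally show "0 \<le> (- 1) ^ (p - i) * newton_remainder (Suc p) f u x" .
qed

text \<open>
  By the recursion, the remainder of \<open>\<Delta>f\<close> at \<open>x\<close> is the difference of two remainders of \<open>f\<close> taken
  in neighbouring unit intervals; their signs are opposite, so no cancellation occurs.
\<close>

lemma alternating_remainder_fdiff:
  assumes "alternating_remainder (Suc p) a f"
  shows "alternating_remainder p a (fdiff f)"
  unfolding alternating_remainder_def
proof (intro allI impI)
  fix u x :: real and i :: nat
  assume u: "a \<le> u" and i: "i \<le> p" and x: "real i < x \<and> x < real i + 1"
  have "0 \<le> (- 1) ^ (Suc p - Suc i) * newton_remainder (Suc (Suc p)) f u (x + 1)"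
    using assms u i x unfolding alternating_remainder_def
    by (elim allE[of _ u] impE allE[of _ "Suc i"] allE[of _ "x + 1"]) auto
  moreover have "0 \<le> (- 1) ^ (Suc p - i) * newton_remainder (Suc (Suc p)) f u x"
    using assms u i x unfolding alternating_remainder_def by auto
  ultimately show "0 \<le> (- 1) ^ (p - i) * newton_remainder (Suc p) (fdiff f) u x"
    using newton_remainder_step[of "Suc p" f u x] i
    by (simp add: Suc_diff_le distrib_left)
qed

section \<open>Summability of the Newton remainder\<close>

text \<open>
  For \<open>p > 0\<close> the values at \<open>x\<close> and \<open>x + 1\<close> have opposite signs, hence each is at most their
  difference in absolute value. For \<open>p = 0\<close> the role of the second value is played by monotonicity:
  \<open>f u \<le> f (u + x) \<le> f (u + 1)\<close>.
\<close>

lemma abs_newton_remainder_unit_interval: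
  assumes alt: "alternating_remainder p a f" and u: "a \<le> u" and x: "0 < x" "x < 1"
  shows "\<bar>newton_remainder (Suc p) f u x\<bar> \<le>
    \<bar>if p = 0 then fdiff f u else newton_remainder p (fdiff f) u x\<bar>"
proof (cases p)
  case 0
  have *: "0 \<le> newton_remainder (Suc 0) f v y" if "a \<le> v" "0 < y" "y < 1" for v y
    using alt that unfolding alternating_remainder_def by (auto simp: 0)
  have "0 \<le> newton_remainder (Suc 0) f u x" using * u x by auto
  moreover have "0 \<le> newton_remainder (Suc 0) f (u + x) (1 - x)" using * u x by auto
  ultimately show ?thesis by (simp add: 0 newton_remainder_def fdiff_def)
next
  case (Suc q)
  have A: "0 \<le> (- 1) ^ p * newton_remainder (Suc p) f u x"
    using alt u x unfolding alternating_remainder_def by force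
  have "0 \<le> (- 1) ^ (p - 1) * newton_remainder (Suc p) f u (x + 1)"
    using alt u x unfolding alternating_remainder_def
    by (elim allE[of _ u] impE allE[of _ 1] allE[of _ "x + 1"]) (auto simp: Suc)
  then have "0 \<le> (- 1) ^ q * newton_remainder (Suc p) f u (x + 1)" by (simp add: Suc)
  with A show ?thesis
    using newton_remainder_step[of p f u x]
    by (cases "even q") (auto simp: Suc)
qed

lemma summable_newton_remainder_step:
  assumes "summable (\<lambda>n. \<bar>newton_remainder (Suc q) f (real n) x\<bar>)"
    and "summable (\<lambda>n. \<bar>newton_remainder q (fdiff f) (real n) x\<bar>)"
  shows "summable (\<lambda>n. \<bar>newton_remainder (Suc q) f (real n) (x + 1)\<bar>)"
  by (rule summable_comparison_test'[OF summable_add[OF assms]])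
    (simp add: newton_remainder_step)

lemma nonneg_real_induct [consumes 1, case_names unit step]:
  assumes "0 \<le> (x :: real)"
    and unit: "\<And>x. 0 \<le> x \<Longrightarrow> x < 1 \<Longrightarrow> P x"
    and step: "\<And>x. 0 \<le> x \<Longrightarrow> P x \<Longrightarrow> P (x + 1)"
  shows "P x"
proof -
  have "P (y + real k)" if "0 \<le> y" "y < 1" for k y
  proof (induction k)
    case (Suc k)
    then show ?case using step[of "y + real k"] that by (simp add: add_ac)
  qed (simp add: unit that)
  from this[of "frac x" "nat \<lfloor>x\<rfloor>"] have "P (frac x + real (nat \<lfloor>x\<rfloor>))"
    by (simp add: frac_lt_1)
  also have "frac x + real (nat \<lfloor>x\<rfloor>) = x" using assms(1) by (simp add: frac_def)
  finally show ?thesis .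
qed

text \<open>
  On the unit interval the sign pattern bounds the remainder by one of lower order for \<open>\<Delta>f\<close>, and
  the recursion carries summability from \<open>x\<close> to \<open>x + 1\<close>. At order \<open>0\<close> the function is eventually
  increasing and converges along the integers, so its increments have a finite sum.
\<close>

lemma summable_newton_remainder_convex:
  assumes "alternating_remainder p a f" and "convergent (\<lambda>n. (fdiff ^^ p) f (real n))" and "0 \<le> x"
  shows "summable (\<lambda>n. \<bar>newton_remainder (Suc p) f (real n) x\<bar>)"
  using assms
proof (induction p arbitrary: f x)
  case 0
  obtain L where L: "(\<lambda>n. f (real n)) \<longlonglongrightarrow> L"
    using "0.prems"(2) by (auto simp: convergent_def)
  have mono: "f v \<le> f (v + y)" if "a \<le> v" "0 < y" "y < 1" for v y
    using "0.prems"(1) that unfolding alternating_remainder_def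
    by (auto simp: newton_remainder_def)
  have nonneg: "0 \<le> fdiff f v" if "a \<le> v" for v
    using mono[of v "1/2"] mono[of "v + 1/2" "1/2"] that by (simp add: fdiff_def add.commute)
  have ev: "eventually (\<lambda>n. a \<le> real n) sequentially"
    by (rule eventually_sequentiallyI[of "nat \<lceil>a\<rceil>"]) linarith
  have "summable (\<lambda>n. f (real (Suc n)) - f (real n))" by (rule telescope_summable[OF L])
  then have fdiff_summable: "summable (\<lambda>n. fdiff f (real n))"
    by (simp add: fdiff_def add.commute)
  have "summable (\<lambda>n. \<bar>fdiff f (real n)\<bar>)"
    by (rule summable_comparison_test_ev[OF _ fdiff_summable])
      (use ev nonneg in \<open>auto elim: eventually_mono\<close>)
  note abs_summable = this
  from \<open>0 \<le> x\<close> show ?case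
  proof (induction x rule: nonneg_real_induct)
    case (unit x)
    show ?case
    proof (cases "x = 0")
      case False
      show ?thesis
        by (rule summable_comparison_test_ev[OF _ abs_summable], rule eventually_mono[OF ev])
          (use abs_newton_remainder_unit_interval[OF "0.prems"(1)] unit False in fastforce)
    qed (simp add: newton_remainder_at_0)
  next
    case (step x)
    have eq: "newton_remainder (Suc 0) f (real n) (x + 1) =
        newton_remainder (Suc 0) f (real (Suc n)) x + fdiff f (real n)" for n
      by (simp add: newton_remainder_def fdiff_def add_ac)
    have "summable (\<lambda>n. \<bar>newton_remainder (Suc 0) f (real (Suc n)) x\<bar>)"
      using step.IH by (subst summable_Suc_iff)
    from summable_add[OF this abs_summable] show ?case
      by (rule summable_comparison_test') (unfold eq, simp add: abs_triangle_ineq del: of_nat_Suc)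
  qed
next
  case (Suc p)
  have ev: "eventually (\<lambda>n. a \<le> real n) sequentially"
    by (rule eventually_sequentiallyI[of "nat \<lceil>a\<rceil>"]) linarith
  have lower: "summable (\<lambda>n. \<bar>newton_remainder (Suc p) (fdiff f) (real n) y\<bar>)" if "0 \<le> y" for y
    using Suc.IH[OF alternating_remainder_fdiff[OF Suc.prems(1)] _ that] Suc.prems(2)
    by (simp only: fdiff_funpow_Suc)
  from \<open>0 \<le> x\<close> show ?case
  proof (induction x rule: nonneg_real_induct)
    case (unit x)
    show ?case
    proof (cases "x = 0")
      case False
      show ?thesis
        by (rule summable_comparison_test_ev[OF _ lower[OF unit(1)]], rule eventually_mono[OF ev])
          (use abs_newton_remainder_unit_interval[OF Suc.prems(1)] unit False in fastforce)
    qed (simp add: newton_remainder_at_0)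
  next
    case (step x)
    then show ?case by (intro summable_newton_remainder_step lower)
  qed
qed

lemma summable_newton_remainder:
  assumes D: "g \<in> D_class p" and K: "g \<in> K_class p" and "0 \<le> x"
  shows "summable (\<lambda>n. newton_remainder (Suc p) g (real n) x)"
proof -
  have lim: "(\<lambda>n. (fdiff ^^ p) g (real n)) \<longlonglongrightarrow> 0" using D by (simp add: D_class_def)
  obtain a where "p_convex_on p {a..} g \<or> p_concave_on p {a..} g"
    using K by (auto simp: K_class_def)
  then show ?thesis
  proof
    assume "p_convex_on p {a..} g"
    from summable_newton_remainder_convex[OF p_convex_imp_alternating_remainder[OF this] _ \<open>0 \<le> x\<close>] lim
    show ?thesis by (blast intro: summable_rabs_cancel convergentI)
  next
    assume "p_concave_on p {a..} g"
    then have "p_convex_on p {a..} (\<lambda>x. - g x)"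
      by (auto simp: p_convex_on_def p_concave_on_def divided_diff_def sum_negf)
    moreover have "(\<lambda>n. (fdiff ^^ p) (\<lambda>x. - g x) (real n)) \<longlonglongrightarrow> 0"
      using tendsto_minus[OF lim] by (simp add: fdiff_funpow_minus)
    ultimately have "summable (\<lambda>n. \<bar>newton_remainder (Suc p) (\<lambda>x. - g x) (real n) x\<bar>)"
      using \<open>0 \<le> x\<close>
      by (blast intro: summable_newton_remainder_convex p_convex_imp_alternating_remainder convergentI)
    then show ?thesis
      by (simp add: newton_remainder_minus summable_rabs_cancel)
  qed
qed

section \<open>The map \<open>\<Sigma>\<close>\<close>

text \<open>
  The series behind the limit: its terms are the remainders of \<open>g\<close> at consecutive integers.
\<close>

lemma Sigma_approx_Suc:
  assumes "n \<ge> 1"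
  shows "Sigma_approx p g (Suc n) x = Sigma_approx p g n x - newton_remainder (Suc p) g (real n) x"
proof -
  have "(\<Sum>j=1..p. (x gchoose j) * (fdiff ^^ (j - 1)) g (real (Suc n))) -
      (\<Sum>j=1..p. (x gchoose j) * (fdiff ^^ (j - 1)) g (real n)) =
      (\<Sum>j=1..p. (x gchoose j) * (fdiff ^^ j) g (real n))"
    unfolding sum_subtractf[symmetric]
  proof (intro sum.cong refl)
    fix j assume "j \<in> {1..p}"
    then obtain i where "j = Suc i" by (cases j) auto
    then show "(x gchoose j) * (fdiff ^^ (j - 1)) g (real (Suc n)) -
      (x gchoose j) * (fdiff ^^ (j - 1)) g (real n) = (x gchoose j) * (fdiff ^^ j) g (real n)"
      by (simp add: fdiff_funpow_Suc_at add.commute right_diff_distrib del: funpow.simps(2))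
  qed
  moreover have "(\<Sum>j<Suc p. (x gchoose j) * (fdiff ^^ j) g (real n)) =
      g (real n) + (\<Sum>j=1..p. (x gchoose j) * (fdiff ^^ j) g (real n))"
    by (simp add: lessThan_Suc_atMost atMost_atLeast0 sum.atLeast_Suc_atMost del: sum.lessThan_Suc)
  moreover have "(\<Sum>k\<in>{1..<Suc n}. g (real k) - g (x + real k)) =
      (\<Sum>k\<in>{1..<n}. g (real k) - g (x + real k)) + (g (real n) - g (x + real n))"
    using assms by simp
  ultimately show ?thesis
    by (simp add: Sigma_approx_def newton_remainder_def add.commute[of x] del: sum.lessThan_Suc)
qed

lemma Sigma_approx_shift:
  assumes "n \<ge> 1"
  shows "Sigma_approx p g n (x + 1) = Sigma_approx p g n x + g x - newton_remainder p g (real n) x"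
proof -
  have "(\<Sum>k\<in>{1..<n}. g (real k) - g (x + real k)) - (\<Sum>k\<in>{1..<n}. g (real k) - g (x + 1 + real k)) =
      (\<Sum>k\<in>{1..<n}. g (x + real (Suc k)) - g (x + real k))"
    by (simp add: add_ac flip: sum_subtractf)
  also have "\<dots> = g (x + real n) - g (x + 1)"
    using sum_Suc_diff'[OF assms, of "\<lambda>k. g (x + real k)"] by simp
  finally have A: "(\<Sum>k\<in>{1..<n}. g (real k) - g (x + 1 + real k)) =
      (\<Sum>k\<in>{1..<n}. g (real k) - g (x + real k)) - g (x + real n) + g (x + 1)"
    by simp
  have "(\<Sum>j=1..p. ((x + 1) gchoose j) * (fdiff ^^ (j - 1)) g (real n)) -
      (\<Sum>j=1..p. (x gchoose j) * (fdiff ^^ (j - 1)) g (real n)) =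
      (\<Sum>j=1..p. (x gchoose (j - 1)) * (fdiff ^^ (j - 1)) g (real n))"
    unfolding sum_subtractf[symmetric]
  proof (intro sum.cong refl)
    fix j assume "j \<in> {1..p}"
    then obtain i where "j = Suc i" by (cases j) auto
    then show "((x + 1) gchoose j) * (fdiff ^^ (j - 1)) g (real n) -
      (x gchoose j) * (fdiff ^^ (j - 1)) g (real n) = (x gchoose (j - 1)) * (fdiff ^^ (j - 1)) g (real n)"
      by (simp add: gbinomial_Suc_Suc distrib_right)
  qed
  also have "\<dots> = (\<Sum>j<p. (x gchoose j) * (fdiff ^^ j) g (real n))"
    by (rule sum.reindex_bij_witness[of _ Suc "\<lambda>j. j - 1"]) auto
  finally show ?thesis
    using A by (simp add: Sigma_approx_def newton_remainder_def add.commute[of x "real n"])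
qed

lemma convergent_Sigma_approx:
  assumes "g \<in> D_class p" "g \<in> K_class p" "0 \<le> x"
  shows "convergent (\<lambda>n. Sigma_approx p g n x)"
proof -
  have eq: "Sigma_approx p g (Suc n) x =
      Sigma_approx p g 1 x - (\<Sum>k<n. newton_remainder (Suc p) g (real (Suc k)) x)" for n
    by (induction n) (use Sigma_approx_Suc[of "Suc _" p g x] in auto)
  have "summable (\<lambda>k. newton_remainder (Suc p) g (real (Suc k)) x)"
    using summable_newton_remainder[OF assms] by (subst summable_Suc_iff)
  then have "convergent (\<lambda>n. \<Sum>k<n. newton_remainder (Suc p) g (real (Suc k)) x)"
    by (simp add: summable_iff_convergent)
  then have "convergent (\<lambda>n. Sigma_approx p g (Suc n) x)"
    unfolding eq by (intro convergent_diff convergent_const)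
  then show ?thesis by (rule convergent_Suc_iff[THEN iffD1])
qed

lemma D_class_mono:
  assumes "g \<in> D_class p" "p \<le> q"
  shows "g \<in> D_class q"
  using assms(2,1)
proof (induction q rule: dec_induct)
  case (step q)
  then have "(\<lambda>n. (fdiff ^^ q) g (real n)) \<longlonglongrightarrow> 0" by (simp add: D_class_def)
  from tendsto_diff[OF LIMSEQ_Suc[OF this] this] show ?case
    by (simp add: D_class_def fdiff_funpow_Suc_at add.commute del: funpow.simps(2))
qed

text \<open>
  Raising the order only adds terms containing \<open>\<Delta>\<^sup>i g(n)\<close> with \<open>i \<ge> p\<close>, all of which tend to \<open>0\<close>.
  Hence the limit does not depend on the order chosen for \<open>g\<close>.
\<close>

lemma Sigma_approx_order_change:
  assumes "g \<in> D_class p" "p \<le> q"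
  shows "(\<lambda>n. Sigma_approx q g n x - Sigma_approx p g n x) \<longlonglongrightarrow> 0"
proof -
  have "(\<lambda>n. \<Sum>j\<in>{p<..q}. (x gchoose j) * (fdiff ^^ (j - 1)) g (real n)) \<longlonglongrightarrow> 0"
  proof (intro tendsto_null_sum tendsto_mult_right_zero)
    fix j assume "j \<in> {p<..q}"
    then have "g \<in> D_class (j - 1)" by (intro D_class_mono[OF assms(1)]) auto
    then show "(\<lambda>n. (fdiff ^^ (j - 1)) g (real n)) \<longlonglongrightarrow> 0" by (simp add: D_class_def)
  qed
  moreover have "{1..q} = {1..p} \<union> {p<..q}" using assms(2) by auto
  then have "(\<Sum>j=1..q. (x gchoose j) * (fdiff ^^ (j - 1)) g (real n)) =
      (\<Sum>j=1..p. (x gchoose j) * (fdiff ^^ (j - 1)) g (real n)) +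
      (\<Sum>j\<in>{p<..q}. (x gchoose j) * (fdiff ^^ (j - 1)) g (real n))" for n
    by (simp only:) (rule sum.union_disjoint, auto)
  ultimately show ?thesis by (simp add: Sigma_approx_def)
qed

lemma Sigma_approx_tendsto:
  assumes "g \<in> D_class p" "g \<in> K_class p" "0 \<le> x"
  shows "(\<lambda>n. Sigma_approx p g n x) \<longlonglongrightarrow> Sigma_map g x"
proof -
  define p0 where "p0 = (LEAST p. g \<in> D_class p \<inter> K_class p)"
  have p0: "g \<in> D_class p0 \<inter> K_class p0"
    unfolding p0_def by (rule LeastI[of _ p]) (use assms in auto)
  have "p0 \<le> p" unfolding p0_def by (rule Least_le) (use assms in auto)
  have "convergent (\<lambda>n. Sigma_approx p0 g n x)"
    using p0 assms(3) by (intro convergent_Sigma_approx) auto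
  then have "(\<lambda>n. Sigma_approx p0 g n x) \<longlonglongrightarrow> Sigma_map g x"
    by (simp add: Sigma_map_def p0_def convergent_LIMSEQ_iff)
  from tendsto_add[OF this Sigma_approx_order_change[of g p0 p x]] p0 \<open>p0 \<le> p\<close>
  show ?thesis by simp
qed

text \<open>
  The order is \<open>p\<close> here, one less than in the summability result: the last interpolation term,
  \<open>\<Delta>\<^sup>p g(n)\<close> times a constant, tends to \<open>0\<close> because \<open>g\<close> lies in \<open>\<D>\<^sup>p\<close>.
\<close>

lemma newton_remainder_tendsto_0:
  assumes "g \<in> D_class p" "g \<in> K_class p" "0 \<le> x"
  shows "(\<lambda>n. newton_remainder p g (real n) x) \<longlonglongrightarrow> 0"
proof -
  have "(\<lambda>n. newton_remainder (Suc p) g (real n) x) \<longlonglongrightarrow> 0"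
    using summable_newton_remainder[OF assms] by (rule summable_LIMSEQ_zero)
  moreover have "(\<lambda>n. (x gchoose p) * (fdiff ^^ p) g (real n)) \<longlonglongrightarrow> 0"
    using assms(1) by (intro tendsto_mult_right_zero) (simp add: D_class_def)
  ultimately have "(\<lambda>n. newton_remainder (Suc p) g (real n) x +
      (x gchoose p) * (fdiff ^^ p) g (real n)) \<longlonglongrightarrow> 0 + 0"
    by (rule tendsto_add)
  then show ?thesis by (simp add: newton_remainder_Suc)
qed

lemma Sigma_map_step:
  assumes "g \<in> D_class p" "g \<in> K_class p" "0 \<le> x"
  shows "Sigma_map g (x + 1) = Sigma_map g x + g x"
proof (rule LIMSEQ_unique)
  show "(\<lambda>n. Sigma_approx p g n (x + 1)) \<longlonglongrightarrow> Sigma_map g (x + 1)"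
    using assms by (intro Sigma_approx_tendsto) auto
  have "(\<lambda>n. Sigma_approx p g n x + g x - newton_remainder p g (real n) x) \<longlonglongrightarrow> Sigma_map g x + g x - 0"
    by (intro tendsto_intros Sigma_approx_tendsto newton_remainder_tendsto_0 assms)
  moreover have "eventually (\<lambda>n. Sigma_approx p g n x + g x - newton_remainder p g (real n) x =
      Sigma_approx p g n (x + 1)) sequentially"
    by (rule eventually_sequentiallyI[of 1]) (simp add: Sigma_approx_shift)
  ultimately have "(\<lambda>n. Sigma_approx p g n (x + 1)) \<longlonglongrightarrow> Sigma_map g x + g x - 0"
    by (rule Lim_transform_eventually)
  then show "(\<lambda>n. Sigma_approx p g n (x + 1)) \<longlonglongrightarrow> Sigma_map g x + g x" by simp
qed

text \<open>
  At \<open>x = 0\<close> every approximant equals \<open>- g 0\<close>, so the value at \<open>1\<close> comes from the step equation;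
  the arbitrary value \<open>g 0\<close> cancels.
\<close>

lemma Sigma_map_1:
  assumes "g \<in> D_class p" "g \<in> K_class p"
  shows "Sigma_map g 1 = 0"
proof -
  have "Sigma_approx p g n 0 = - g 0" for n
    by (simp add: Sigma_approx_def gbinomial_0_left)
  then have "Sigma_map g 0 = - g 0"
    using Sigma_approx_tendsto[OF assms, of 0] by (simp add: LIMSEQ_const_iff)
  then show ?thesis using Sigma_map_step[OF assms, of 0] by simp
qed

lemma Sigma_approx_eq_remainder:
  assumes f: "\<And>y. y > 0 \<Longrightarrow> f (y + 1) - f y = g y" and "x > 0" "n \<ge> 1"
  shows "Sigma_approx p g n x = f x - f 1 - newton_remainder (Suc p) f (real n) x"
proof -
  have sum1: "(\<Sum>k\<in>{1..<n}. g (real k)) = f (real n) - f 1"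
    using sum_Suc_diff'[OF \<open>n \<ge> 1\<close>, of "\<lambda>k. f (real k)"]
    by (simp add: f[symmetric] add.commute)
  have "(\<Sum>k\<in>{1..<n}. g (x + real k)) = f (x + real n) - f (x + 1)"
    using sum_Suc_diff'[OF \<open>n \<ge> 1\<close>, of "\<lambda>k. f (x + real k)"] \<open>x > 0\<close>
    by (simp add: f[symmetric] add_ac)
  then have sum2: "g x + (\<Sum>k\<in>{1..<n}. g (x + real k)) = f (x + real n) - f x"
    using f[OF \<open>x > 0\<close>] by simp
  have "(fdiff ^^ (j - 1)) g (real n) = (fdiff ^^ j) f (real n)" if "j \<in> {1..p}" for j
  proof -
    have "(fdiff ^^ (j - 1)) g (real n) = (fdiff ^^ (j - 1)) (fdiff f) (real n)"
      by (rule fdiff_funpow_cong) (use f \<open>n \<ge> 1\<close> in \<open>auto simp: fdiff_def\<close>)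
    also have "\<dots> = (fdiff ^^ Suc (j - 1)) f (real n)" by (simp only: fdiff_funpow_Suc)
    also have "Suc (j - 1) = j" using that by simp
    finally show ?thesis .
  qed
  then have "(\<Sum>j=1..p. (x gchoose j) * (fdiff ^^ (j - 1)) g (real n)) =
      (\<Sum>j=1..p. (x gchoose j) * (fdiff ^^ j) f (real n))"
    by (intro sum.cong) auto
  moreover have "(\<Sum>j<Suc p. (x gchoose j) * (fdiff ^^ j) f (real n)) =
      f (real n) + (\<Sum>j=1..p. (x gchoose j) * (fdiff ^^ j) f (real n))"
    by (simp add: lessThan_Suc_atMost atMost_atLeast0 sum.atLeast_Suc_atMost del: sum.lessThan_Suc)
  ultimately show ?thesis
    using sum1 sum2
    by (simp add: Sigma_approx_def newton_remainder_def sum_subtractf add.commute[of x]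
        del: sum.lessThan_Suc)
qed

text \<open>
  This takes the place of the uniqueness of solutions of \<open>\<Delta>f = g\<close>: instead of a convexity
  assumption on \<open>f\<close> it asks for vanishing remainders, which is easier to transfer between functions.
\<close>

lemma Sigma_map_eqI:
  assumes g: "g \<in> D_class p" "g \<in> K_class p"
    and f: "\<And>y. y > 0 \<Longrightarrow> f (y + 1) - f y = g y"
    and R: "(\<lambda>n. newton_remainder (Suc p) f (real n) x) \<longlonglongrightarrow> 0" and "x > 0"
  shows "Sigma_map g x = f x - f 1"
proof (rule LIMSEQ_unique)
  show "(\<lambda>n. Sigma_approx p g n x) \<longlonglongrightarrow> Sigma_map g x"
    using assms by (intro Sigma_approx_tendsto) auto
  have "(\<lambda>n. f x - f 1 - newton_remainder (Suc p) f (real n) x) \<longlonglongrightarrow> f x - f 1 - 0"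
    by (intro tendsto_intros R)
  moreover have "eventually (\<lambda>n. f x - f 1 - newton_remainder (Suc p) f (real n) x =
      Sigma_approx p g n x) sequentially"
    by (rule eventually_sequentiallyI[of 1]) (simp add: Sigma_approx_eq_remainder[of f g, OF f \<open>x > 0\<close>])
  ultimately have "(\<lambda>n. Sigma_approx p g n x) \<longlonglongrightarrow> f x - f 1 - 0"
    by (rule Lim_transform_eventually)
  then show "(\<lambda>n. Sigma_approx p g n x) \<longlonglongrightarrow> f x - f 1" by simp
qed

section \<open>Asymptotically polynomial functions\<close>

text \<open>
  Near \<open>n\<close> the function is a polynomial of bounded degree up to an error tending to \<open>0\<close>. The
  polynomials may vary freely with \<open>n\<close>, which is what makes the notion stable under affine
  substitutions.
\<close>

definition asymp_poly :: "nat \<Rightarrow> (real \<Rightarrow> real) \<Rightarrow> bool" where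
  "asymp_poly p f \<longleftrightarrow> (\<exists>P :: nat \<Rightarrow> real poly. (\<forall>n. degree (P n) \<le> p) \<and>
     (\<forall>t\<ge>0. (\<lambda>n. f (real n + t) - poly (P n) t) \<longlonglongrightarrow> 0))"

text \<open>
  The approximating polynomials are the Newton interpolation polynomials of \<open>\<Sigma>g\<close> itself: their
  error is \<open>\<Sigma>g\<close> minus its own approximants.
\<close>

lemma asymp_poly_Sigma_map:
  assumes g: "g \<in> D_class p" "g \<in> K_class p"
  shows "asymp_poly p (Sigma_map g)"
  unfolding asymp_poly_def
proof (intro exI[of _ "\<lambda>n. newton_poly p (Sigma_map g) (real n)"] conjI allI impI)
  fix t :: real assume "0 \<le> t"
  have "(\<lambda>n. newton_remainder (Suc p) (Sigma_map g) (real n) t) \<longlonglongrightarrow> 0"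
  proof (cases "t = 0")
    case False
    then have "t > 0" using \<open>0 \<le> t\<close> by simp
    have "(\<lambda>n. Sigma_map g t - Sigma_approx p g n t) \<longlonglongrightarrow> Sigma_map g t - Sigma_map g t"
      using g \<open>0 \<le> t\<close> by (intro tendsto_intros Sigma_approx_tendsto)
    moreover have "Sigma_map g t - Sigma_approx p g n t =
        newton_remainder (Suc p) (Sigma_map g) (real n) t" if "n \<ge> 1" for n
      using Sigma_approx_eq_remainder[of "Sigma_map g" g t n p] Sigma_map_step[OF g]
        Sigma_map_1[OF g] \<open>t > 0\<close> that by simp
    then have "eventually (\<lambda>n. Sigma_map g t - Sigma_approx p g n t =
        newton_remainder (Suc p) (Sigma_map g) (real n) t) sequentially"
      by (rule eventually_sequentiallyI)
    ultimately have "(\<lambda>n. newton_remainder (Suc p) (Sigma_map g) (real n) t) \<longlonglongrightarrow>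
        Sigma_map g t - Sigma_map g t"
      by (rule Lim_transform_eventually)
    then show ?thesis by simp
  qed (simp add: newton_remainder_at_0)
  then show "(\<lambda>n. Sigma_map g (real n + t) - poly (newton_poly p (Sigma_map g) (real n)) t) \<longlonglongrightarrow> 0"
    by (simp add: newton_remainder_eq_poly)
qed (rule degree_newton_poly)

lemma asymp_poly_sum:
  assumes "\<And>i. i \<in> A \<Longrightarrow> asymp_poly p (f i)"
  shows "asymp_poly p (\<lambda>x. \<Sum>i\<in>A. f i x)"
proof -
  have "\<forall>i\<in>A. \<exists>P. (\<forall>n. degree (P n) \<le> p) \<and>
      (\<forall>t\<ge>0. (\<lambda>n. f i (real n + t) - poly (P n) t) \<longlonglongrightarrow> 0)"
    using assms unfolding asymp_poly_def by blast
  from bchoice[OF this] obtain P where deg: "\<And>i n. i \<in> A \<Longrightarrow> degree (P i n) \<le> p"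
    and lim: "\<And>i t. i \<in> A \<Longrightarrow> t \<ge> 0 \<Longrightarrow> (\<lambda>n. f i (real n + t) - poly (P i n) t) \<longlonglongrightarrow> 0"
    by blast
  have "degree (\<Sum>i\<in>A. P i n) \<le> p" for n
  proof (cases "finite A")
    case True
    then show ?thesis using deg by (intro degree_sum_le) auto
  qed simp
  moreover have "(\<lambda>n. (\<Sum>i\<in>A. f i (real n + t)) - poly (\<Sum>i\<in>A. P i n) t) \<longlonglongrightarrow> 0" if "t \<ge> 0" for t
    using tendsto_null_sum[of A "\<lambda>n i. f i (real n + t) - poly (P i n) t" sequentially] lim that
    by (simp add: poly_sum sum_subtractf)
  ultimately show ?thesis
    unfolding asymp_poly_def by (intro exI[of _ "\<lambda>n. \<Sum>i\<in>A. P i n"]) auto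
qed

text \<open>
  With \<open>n = m * q + r\<close> and \<open>r < m\<close>, the argument \<open>(n + t + b) / m\<close> is \<open>q + (r + t + b) / m\<close>. The
  polynomial for \<open>q\<close> therefore serves for \<open>n\<close> after an affine substitution, and since \<open>r\<close> takes only
  finitely many values the errors for all of them are bounded by one null sequence in \<open>q\<close>.
\<close>

lemma asymp_poly_scale:
  assumes f: "asymp_poly p f" and m: "m \<ge> 1" and b: "b \<ge> 0"
  shows "asymp_poly p (\<lambda>x. f ((x + b) / real m))"
proof -
  obtain P where deg: "\<And>n. degree (P n) \<le> p"
    and lim: "\<And>t. t \<ge> 0 \<Longrightarrow> (\<lambda>n. f (real n + t) - poly (P n) t) \<longlonglongrightarrow> 0"
    using f unfolding asymp_poly_def by blast
  define Q where "Q n = pcompose (P (n div m)) [:(real (n mod m) + b) / real m, 1 / real m:]" for n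
  have Q: "poly (Q n) t = poly (P (n div m)) ((real (n mod m) + t + b) / real m)" for n t
    by (simp add: Q_def poly_pcompose add_divide_distrib add_ac)
  have "degree (Q n) \<le> p" for n
    using degree_pcompose_le[of "P (n div m)" "[:(real (n mod m) + b) / real m, 1 / real m:]"]
      deg[of "n div m"] m by (simp add: Q_def)
  moreover have "(\<lambda>n. f ((real n + t + b) / real m) - poly (Q n) t) \<longlonglongrightarrow> 0" if t: "t \<ge> 0" for t
  proof -
    define E where "E n r = \<bar>f (real n + (real r + t + b) / real m) - poly (P n) ((real r + t + b) / real m)\<bar>"
      for n r
    have "(\<lambda>n. E n r) \<longlonglongrightarrow> 0" for r
      unfolding E_def using lim[of "(real r + t + b) / real m"] t b m
      by (intro tendsto_rabs_zero) auto
    then have "(\<lambda>n. \<Sum>r<m. E n r) \<longlonglongrightarrow> 0" by (intro tendsto_null_sum) auto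
    moreover have "filterlim (\<lambda>n. n div m) sequentially sequentially"
      using m by (intro filterlim_at_top_div_const_nat) simp
    ultimately have lim0: "(\<lambda>n. \<Sum>r<m. E (n div m) r) \<longlonglongrightarrow> 0" by (rule filterlim_compose)
    have "\<bar>f ((real n + t + b) / real m) - poly (Q n) t\<bar> \<le> (\<Sum>r<m. E (n div m) r)" for n
    proof -
      have "real n = real m * real (n div m) + real (n mod m)"
        by (metis of_nat_add of_nat_mult mult_div_mod_eq)
      then have "(real n + t + b) / real m = real (n div m) + (real (n mod m) + t + b) / real m"
        using m by (simp add: field_simps)
      then have "\<bar>f ((real n + t + b) / real m) - poly (Q n) t\<bar> = E (n div m) (n mod m)"
        by (simp add: E_def Q)
      also have "\<dots> \<le> (\<Sum>r<m. E (n div m) r)"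
        using m by (intro member_le_sum) (auto simp: E_def)
      finally show ?thesis .
    qed
    then show ?thesis by (intro tendsto_0_le[OF lim0, of _ 1]) (auto simp: E_def sum_nonneg)
  qed
  ultimately show ?thesis
    unfolding asymp_poly_def by (intro exI[of _ Q]) auto
qed

lemma fdiff_funpow_tendsto_0:
  assumes "\<And>t. t \<ge> 0 \<Longrightarrow> (\<lambda>n. h n (real n + t)) \<longlonglongrightarrow> 0" and "t \<ge> 0"
  shows "(\<lambda>n. (fdiff ^^ j) (h n) (real n + t)) \<longlonglongrightarrow> 0"
  using assms(2)
proof (induction j arbitrary: t)
  case (Suc j)
  from tendsto_diff[OF Suc.IH[of "t + 1"] Suc.IH[of t]] Suc.prems show ?case
    by (simp add: fdiff_funpow_Suc_at add.assoc del: funpow.simps(2))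
qed (simp add: assms(1))

text \<open>
  The remainder is linear in the function and kills the polynomial part, so it is a combination of
  finitely many values of the error, with coefficients independent of \<open>n\<close>.
\<close>

lemma asymp_poly_newton_remainder:
  assumes f: "asymp_poly p f" and x: "x \<ge> 0"
  shows "(\<lambda>n. newton_remainder (Suc p) f (real n) x) \<longlonglongrightarrow> 0"
proof -
  obtain P where deg: "\<And>n. degree (P n) \<le> p"
    and lim: "\<And>t. t \<ge> 0 \<Longrightarrow> (\<lambda>n. f (real n + t) - poly (P n) t) \<longlonglongrightarrow> 0"
    using f unfolding asymp_poly_def by blast
  define Q where "Q n = pcompose (P n) [:- real n, 1:]" for n
  define h where "h n = (\<lambda>z. f z - poly (Q n) z)" for n
  have "degree (Q n) \<le> p" for n
    using degree_pcompose_le[of "P n" "[:- real n, 1:]"] deg[of n] by (simp add: Q_def)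
  then have "newton_remainder (Suc p) f (real n) x = newton_remainder (Suc p) (h n) (real n) x" for n
    by (simp add: h_def newton_remainder_diff newton_remainder_poly)
  moreover have h: "(\<lambda>n. h n (real n + t)) \<longlonglongrightarrow> 0" if "t \<ge> 0" for t
    using lim[OF that] by (simp add: h_def Q_def poly_pcompose)
  have "(\<lambda>n. (fdiff ^^ j) (h n) (real n)) \<longlonglongrightarrow> 0" for j
    using fdiff_funpow_tendsto_0[of h 0 j, OF h] by simp
  then have "(\<lambda>n. h n (real n + x) - (\<Sum>j<Suc p. (x gchoose j) * (fdiff ^^ j) (h n) (real n))) \<longlonglongrightarrow> 0 - 0"
    by (intro tendsto_diff h x tendsto_null_sum tendsto_mult_right_zero)
  ultimately show ?thesis by (simp add: newton_remainder_def del: sum.lessThan_Suc)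
qed

text \<open>
  At the node \<open>x = p + 1\<close> the interpolation with one more term is exact, so the remainder there is
  precisely the missing term \<open>\<Delta>\<^sup>p\<^sup>+\<^sup>1 f(n)\<close>.
\<close>

lemma asymp_poly_fdiff_funpow:
  assumes "asymp_poly p f"
  shows "(\<lambda>n. (fdiff ^^ Suc p) f (real n)) \<longlonglongrightarrow> 0"
proof -
  have one: "real (Suc p) gchoose Suc p = 1"
    using binomial_gbinomial[of "Suc p" "Suc p", where 'a = real] by (simp del: of_nat_Suc)
  have "newton_remainder (Suc p) f (real n) (real (Suc p)) = (fdiff ^^ Suc p) f (real n)" for n
    using newton_remainder_node[of "Suc p" "Suc (Suc p)" f "real n"]
    unfolding newton_remainder_Suc[of "Suc p"] one by simp
  with asymp_poly_newton_remainder[OF assms, of "real (Suc p)"] show ?thesis by simp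
qed

section \<open>The multiplication formula\<close>

lemma divided_diff_scale:
  assumes "m \<ge> 1" and h: "\<And>k. k \<le> n \<Longrightarrow> h (x k) = g (x k / real m)"
  shows "divided_diff g (\<lambda>k. x k / real m) n = real m ^ n * divided_diff h x n"
  unfolding divided_diff_def sum_distrib_left
proof (intro sum.cong refl)
  fix k assume k: "k \<in> {..n}"
  have "(\<Prod>j\<in>{..n} - {k}. x k / real m - x j / real m) =
      (\<Prod>j\<in>{..n} - {k}. x k - x j) / real m ^ n"
    using k by (simp add: prod_dividef flip: diff_divide_distrib)
  then show "g (x k / real m) / (\<Prod>j\<in>{..n} - {k}. x k / real m - x j / real m) =
      real m ^ n * (h (x k) / (\<Prod>j\<in>{..n} - {k}. x k - x j))"
    using k h by simp
qed

lemma K_class_scale: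
  assumes g: "g \<in> K_class p" and m: "m \<ge> 1"
    and h: "\<And>x. x > 0 \<Longrightarrow> h x = g (x / real m)"
  shows "h \<in> K_class p"
proof -
  obtain a where a: "a > 0" and cvx: "p_convex_on p {a..} g \<or> p_concave_on p {a..} g"
    using g by (auto simp: K_class_def)
  have nodes: "strict_mono_on {..p + 1} (\<lambda>k. x k / real m)" "(\<lambda>k. x k / real m) ` {..p + 1} \<subseteq> {a..}"
    "divided_diff g (\<lambda>k. x k / real m) (p + 1) = real m ^ (p + 1) * divided_diff h x (p + 1)"
    if x: "strict_mono_on {..p + 1} x" "x ` {..p + 1} \<subseteq> {a * real m..}" for x
  proof -
    show "strict_mono_on {..p + 1} (\<lambda>k. x k / real m)"
      using x(1) m by (auto simp: strict_mono_on_def divide_strict_right_mono)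
    show "(\<lambda>k. x k / real m) ` {..p + 1} \<subseteq> {a..}"
      using x(2) m by (auto simp: field_simps image_subset_iff)
    have "x k > 0" if "k \<le> p + 1" for k
    proof -
      have "0 < a * real m" using a m by simp
      also have "\<dots> \<le> x k" using x(2) that by auto
      finally show ?thesis .
    qed
    then show "divided_diff g (\<lambda>k. x k / real m) (p + 1) = real m ^ (p + 1) * divided_diff h x (p + 1)"
      by (intro divided_diff_scale m h) auto
  qed
  have mp: "real m ^ (p + 1) > 0" using m by simp
  have "p_convex_on p {a * real m..} h" if "p_convex_on p {a..} g"
    unfolding p_convex_on_def
  proof (intro allI impI, elim conjE)
    fix x assume x: "strict_mono_on {..p + 1} x" "x ` {..p + 1} \<subseteq> {a * real m..}"
    have "0 \<le> real m ^ (p + 1) * divided_diff h x (p + 1)"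
      using that nodes[OF x] unfolding p_convex_on_def by auto
    then show "0 \<le> divided_diff h x (p + 1)" using mp by (simp only: zero_le_mult_iff) linarith
  qed
  moreover have "p_concave_on p {a * real m..} h" if "p_concave_on p {a..} g"
    unfolding p_concave_on_def
  proof (intro allI impI, elim conjE)
    fix x assume x: "strict_mono_on {..p + 1} x" "x ` {..p + 1} \<subseteq> {a * real m..}"
    have "real m ^ (p + 1) * divided_diff h x (p + 1) \<le> 0"
      using that nodes[OF x] unfolding p_concave_on_def by auto
    then show "divided_diff h x (p + 1) \<le> 0" using mp by (simp only: mult_le_0_iff) linarith
  qed
  moreover have "a * real m > 0" using a m by simp
  ultimately show ?thesis using cvx unfolding K_class_def by blast
qed

theorem theorem8p27:
  fixes g g_m :: "real \<Rightarrow> real" and m :: nat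
  assumes "g \<in> dom_Sigma"
    and "m \<ge> 1"
    and "\<And>x. x > 0 \<Longrightarrow> g_m x = g (x / real m)"
  shows "(\<forall>x>0. (\<Sum>j=0..m-1. Sigma_map g ((x + real j) / real m)) =
                (\<Sum>j=1..m. Sigma_map g (real j / real m)) + Sigma_map g_m x) \<and>
         Sigma_map g_m (real m) = (\<Sum>j=1..m-1. g (real j / real m))"
proof -
  obtain p where g: "g \<in> D_class p" "g \<in> K_class p"
    using assms(1) by (auto simp: dom_Sigma_def)
  define f where "f = Sigma_map g"
  define F where "F x = (\<Sum>j<m. f ((x + real j) / real m))" for x
  have step: "f (y + 1) = f y + g y" if "y \<ge> 0" for y
    using Sigma_map_step[OF g that] by (simp add: f_def)
  have F_step: "F (y + 1) - F y = g_m y" if "y > 0" for y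
  proof -
    have "F (y + 1) - F y = (\<Sum>j<m. f ((y + real (Suc j)) / real m) - f ((y + real j) / real m))"
      by (simp add: F_def add_ac flip: sum_subtractf)
    also have "\<dots> = f ((y + real m) / real m) - f (y / real m)"
      by (subst sum_lessThan_telescope) simp
    also have "(y + real m) / real m = y / real m + 1" using assms(2) by (simp add: field_simps)
    finally show ?thesis using step[of "y / real m"] assms(3) that by simp
  qed
  \<comment> \<open>approximate polynomiality passes to \<open>F\<close> and makes \<open>F\<close> the solution selected by \<open>\<Sigma>\<close>\<close>
  have "asymp_poly p f" unfolding f_def by (rule asymp_poly_Sigma_map[OF g])
  then have F_asymp: "asymp_poly p F"
    unfolding F_def using assms(2) by (intro asymp_poly_sum asymp_poly_scale) auto
  have "(fdiff ^^ Suc p) F (real n) = (fdiff ^^ p) g_m (real n)" if "n \<ge> 1" for n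
    unfolding fdiff_funpow_Suc
    by (rule fdiff_funpow_cong) (use F_step that in \<open>auto simp: fdiff_def\<close>)
  then have "eventually (\<lambda>n. (fdiff ^^ Suc p) F (real n) = (fdiff ^^ p) g_m (real n)) sequentially"
    by (rule eventually_sequentiallyI)
  with asymp_poly_fdiff_funpow[OF F_asymp] have "g_m \<in> D_class p"
    unfolding D_class_def mem_Collect_eq by (rule Lim_transform_eventually)
  moreover have "g_m \<in> K_class p" by (rule K_class_scale[OF g(2) assms(2,3)])
  ultimately have main: "Sigma_map g_m x = F x - F 1" if "x > 0" for x
    using that F_step asymp_poly_newton_remainder[OF F_asymp] by (intro Sigma_map_eqI) auto
  have ivl: "{0..m-1} = {..<m}" using assms(2) by auto
  have F1: "F 1 = (\<Sum>j=1..m. f (real j / real m))"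
    unfolding F_def by (rule sum.reindex_bij_witness[of _ "\<lambda>j. j - 1" Suc]) auto
  have first: "(\<Sum>j=0..m-1. f ((x + real j) / real m)) =
      (\<Sum>j=1..m. f (real j / real m)) + Sigma_map g_m x" if "x > 0" for x
    unfolding ivl F1[symmetric] main[OF that] by (simp add: F_def)
  \<comment> \<open>at \<open>x = m\<close> each summand is a shift by \<open>1\<close> of a summand of \<open>F 1\<close>, apart from \<open>j = 0\<close>,
    which gives the term \<open>j = m\<close> of \<open>F 1\<close>\<close>
  have "F (real m) = (\<Sum>j\<in>insert 0 {1..m-1}. f (real j / real m + 1))"
    unfolding F_def using assms(2) by (intro sum.cong) (auto simp: field_simps)
  also have "\<dots> = f 1 + (\<Sum>j=1..m-1. f (real j / real m + 1))" by simp
  also have "(\<Sum>j=1..m-1. f (real j / real m + 1)) =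
      (\<Sum>j=1..m-1. f (real j / real m)) + (\<Sum>j=1..m-1. g (real j / real m))"
    by (simp add: step sum.distrib)
  finally have Fm: "F (real m) = f 1 + (\<Sum>j=1..m-1. f (real j / real m)) + (\<Sum>j=1..m-1. g (real j / real m))"
    by simp
  have "{1..m} = insert m {1..m-1}" using assms(2) by auto
  then have "F 1 = f 1 + (\<Sum>j=1..m-1. f (real j / real m))"
    using assms(2) by (simp add: F1)
  with Fm have "Sigma_map g_m (real m) = (\<Sum>j=1..m-1. g (real j / real m))"
    using main[of "real m"] assms(2) by simp
  with first show ?thesis by (simp add: f_def)
qed

end
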